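(* Let $\mathbf P$ be a finite poset, $A=\Bbbk[\mathbf P]$, $M\in\operatorname{mod}A$, and $I$ an interval of $\mathbf P$. If $V_I$ is isomorphic to a direct summand of $M$, then $I\in\operatorname{crt}'_{1,\mathrm{zp}}(M)$.
   Context: $\Bbbk$ is a field; $\mathbf P$ is viewed as a category with one morphism $p_{y,x}\colon x\to y$ when $x\le y$; $A=\Bbbk[\mathbf P]$ is its $\Bbbk$-linearization and $\operatorname{mod}A$ is the category of $\Bbbk$-linear functors from $A$ to finite-dimensional $\Bbbk$-vector spaces; $M_{y,x}:=M(p_{y,x})$. An interval of $\mathbf P$ is a nonempty connected convex full subposet; $\mathbb I$ is the set of all intervals. $V_I$ has $V_I(x)=\Bbbk$ for $x\in I$, $0$ otherwise, with identity structure maps inside $I$ and zero otherwise. For $U\subseteq\mathbf P$, $\mathrm{sc}(U)$ and $\mathrm{sk}(U)$ are the sets of minimal and maximal elements of $U$. ${\uparrow}I=\{y\in\mathbf P\mid y\ge x\text{ for some }x\in I\}$, ${\downarrow}I=\{y\in\mathbf P\mid y\le x\text{ for some }x\in I\}$, ${\Uparrow}I={\uparrow}I\setminus I$, ${\Downarrow}I={\downarrow}I\setminus I$. For $N\in\operatorname{mod}A$, $\operatorname{supp}N=\{x\mid N(x)\neq0\}$, $\operatorname{top}N=N/\operatorname{rad}N$, $\operatorname{soc}N$ is the socle. $P_1(M)$ is the degree-1 term of a minimal projective resolution of $M$, and $Q^1(M)$ the degree-1 term of a minimal injective coresolution of $M$. Definitions: $\operatorname{crt}_0(M)=\{I\in\mathbb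 I\mid\mathrm{sc}(I)\subseteq\operatorname{supp}(\operatorname{top}M),\ \mathrm{sk}(I)\subseteq\operatorname{supp}(\operatorname{soc}M)\}$; $\operatorname{crt}'_1(M)=\{I\in\operatorname{crt}_0(M)\mid\mathrm{sc}({\Uparrow}I)\subseteq\operatorname{supp}(\operatorname{top}P_1(M)),\ \mathrm{sk}({\Downarrow}I)\subseteq\operatorname{supp}(\operatorname{soc}Q^1(M))\}$; $\operatorname{crt}_{\mathrm{zp}}(M)=\{I\in\mathbb I\mid M_{b,a}\ne0\text{ for all }(a,b)\in\mathrm{sc}(I)\times\mathrm{sk}(I)\text{ with }a\le b\}$; $\operatorname{crt}'_{1,\mathrm{zp}}(M)=\operatorname{crt}'_1(M)\cap\operatorname{crt}_{\mathrm{zp}}(M)$. *)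

theory Defs
  imports "HOL-Algebra.AbelCoset" "Jordan_Normal_Form.Missing_VectorSpace"
begin

section \<open>Subsets of a poset\<close>

definition sc :: "'p::order set \<Rightarrow> 'p set" where
  "sc U = {x \<in> U. \<forall>y\<in>U. y \<le> x \<longrightarrow> y = x}"

definition sk :: "'p::order set \<Rightarrow> 'p set" where
  "sk U = {x \<in> U. \<forall>y\<in>U. x \<le> y \<longrightarrow> y = x}"

definition upset :: "'p::order set \<Rightarrow> 'p set" where
  "upset I = {y. \<exists>x\<in>I. x \<le> y}"

definition downset :: "'p::order set \<Rightarrow> 'p set" where
  "downset I = {y. \<exists>x\<in>I. y \<le> x}"

definition strict_upset :: "'p::order set \<Rightarrow> 'p set" where
  "strict_upset I = upset I - I"

definition strict_downset :: "'p::order set \<Rightarrow> 'p set" where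
  "strict_downset I = downset I - I"

definition convex_subset :: "'p::order set \<Rightarrow> bool" where
  "convex_subset I \<longleftrightarrow> (\<forall>x\<in>I. \<forall>z\<in>I. \<forall>y. x \<le> y \<and> y \<le> z \<longrightarrow> y \<in> I)"

definition connected_subset :: "'p::order set \<Rightarrow> bool" where
  "connected_subset I \<longleftrightarrow>
     (\<forall>x\<in>I. \<forall>y\<in>I. (x, y) \<in> {(a, b). a \<in> I \<and> b \<in> I \<and> (a \<le> b \<or> b \<le> a)}\<^sup>*)"

definition intervals :: "'p::order set set" where
  "intervals = {I. I \<noteq> {} \<and> connected_subset I \<and> convex_subset I}"


section \<open>The category of modules over the incidence category\<close>

text \<open>
  A \<open>K\<close>-linear functor from the linearization of \<open>'p\<close> sends \<open>c p\<^sub>y\<^sub>x\<close> to \<open>c M\<^sub>y\<^sub>x\<close>, so it is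
  given by the spaces \<open>ob M x\<close> and the maps \<open>mor M y x\<close> from \<open>ob M x\<close> to \<open>ob M y\<close>; note the order
  of the indices. The values of \<open>mor M y x\<close> are irrelevant unless \<open>x \<le> y\<close>.
\<close>

record ('p, 'k, 'v) pmod =
  ob :: "'p \<Rightarrow> ('k, 'v) module"
  mor :: "'p \<Rightarrow> 'p \<Rightarrow> 'v \<Rightarrow> 'v"

definition pmodule :: "'k ring \<Rightarrow> ('p::order, 'k, 'v) pmod \<Rightarrow> bool" where
  "pmodule K M \<longleftrightarrow>
     (\<forall>x. vectorspace K (ob M x) \<and> vectorspace.fin_dim K (ob M x)) \<and>
     (\<forall>x y. x \<le> y \<longrightarrow> linear_map K (ob M x) (ob M y) (mor M y x)) \<and>
     (\<forall>x. \<forall>v\<in>carrier (ob M x). mor M x x v = v) \<and>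
     (\<forall>x y z. x \<le> y \<longrightarrow> y \<le> z \<longrightarrow>
        (\<forall>v\<in>carrier (ob M x). mor M z x v = mor M z y (mor M y x v)))"

definition pmod_hom ::
    "'k ring \<Rightarrow> ('p::order, 'k, 'v) pmod \<Rightarrow> ('p, 'k, 'w) pmod \<Rightarrow> ('p \<Rightarrow> 'v \<Rightarrow> 'w) \<Rightarrow> bool" where
  "pmod_hom K M N f \<longleftrightarrow>
     (\<forall>x. linear_map K (ob M x) (ob N x) (f x)) \<and>
     (\<forall>x y. x \<le> y \<longrightarrow> (\<forall>v\<in>carrier (ob M x). f y (mor M y x v) = mor N y x (f x v)))"

definition pmod_mono :: "('p, 'k, 'v) pmod \<Rightarrow> ('p \<Rightarrow> 'v \<Rightarrow> 'w) \<Rightarrow> bool" where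
  "pmod_mono M f \<longleftrightarrow> (\<forall>x. inj_on (f x) (carrier (ob M x)))"

definition pmod_ker ::
    "('p, 'k, 'v) pmod \<Rightarrow> ('p, 'k, 'w) pmod \<Rightarrow> ('p \<Rightarrow> 'v \<Rightarrow> 'w) \<Rightarrow> 'p \<Rightarrow> 'v set" where
  "pmod_ker M N f = (\<lambda>x. {v \<in> carrier (ob M x). f x v = \<zero>\<^bsub>ob N x\<^esub>})"

definition pmod_im :: "('p, 'k, 'v) pmod \<Rightarrow> ('p \<Rightarrow> 'v \<Rightarrow> 'w) \<Rightarrow> 'p \<Rightarrow> 'w set" where
  "pmod_im M f = (\<lambda>x. f x ` carrier (ob M x))"

definition whole :: "('p, 'k, 'v) pmod \<Rightarrow> 'p \<Rightarrow> 'v set" where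
  "whole M = (\<lambda>x. carrier (ob M x))"

definition null :: "('p, 'k, 'v) pmod \<Rightarrow> 'p \<Rightarrow> 'v set" where
  "null M = (\<lambda>x. {\<zero>\<^bsub>ob M x\<^esub>})"

definition pmod_epi :: "('p, 'k, 'v) pmod \<Rightarrow> ('p, 'k, 'w) pmod \<Rightarrow> ('p \<Rightarrow> 'v \<Rightarrow> 'w) \<Rightarrow> bool" where
  "pmod_epi M N f \<longleftrightarrow> pmod_im M f = whole N"

definition pmod_iso :: "'k ring \<Rightarrow> ('p::order, 'k, 'v) pmod \<Rightarrow> ('p, 'k, 'w) pmod \<Rightarrow> bool" where
  "pmod_iso K M N \<longleftrightarrow>
     (\<exists>f. pmod_hom K M N f \<and> (\<forall>x. bij_betw (f x) (carrier (ob M x)) (carrier (ob N x))))"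

definition supp :: "('p, 'k, 'v) pmod \<Rightarrow> 'p set" where
  "supp M = {x. carrier (ob M x) \<noteq> {\<zero>\<^bsub>ob M x\<^esub>}}"


section \<open>Submodules, quotients, direct summands\<close>

text \<open>Submodules are families of subspaces, ordered by the pointwise order on \<open>'p \<Rightarrow> 'v set\<close>.\<close>

definition submod :: "'k ring \<Rightarrow> ('p::order, 'k, 'v) pmod \<Rightarrow> ('p \<Rightarrow> 'v set) \<Rightarrow> bool" where
  "submod K M U \<longleftrightarrow>
     (\<forall>x. subspace K (U x) (ob M x)) \<and>
     (\<forall>x y. x \<le> y \<longrightarrow> mor M y x ` U x \<subseteq> U y)"

definition sub_pmod :: "('p, 'k, 'v) pmod \<Rightarrow> ('p \<Rightarrow> 'v set) \<Rightarrow> ('p, 'k, 'v) pmod" where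
  "sub_pmod M U = M\<lparr>ob := (\<lambda>x. (ob M x)\<lparr>carrier := U x\<rparr>)\<rparr>"

text \<open>The fields \<open>mult\<close> and \<open>one\<close> of a \<open>module\<close> record play no role for vector spaces.\<close>

definition quot_space :: "('k, 'v) module \<Rightarrow> 'v set \<Rightarrow> ('k, 'v set) module" where
  "quot_space V U =
     \<lparr>carrier = a_rcosets\<^bsub>V\<^esub> U, mult = (\<lambda>X Y. U), one = U,
      zero = U, add = (\<lambda>X Y. X <+>\<^bsub>V\<^esub> Y),
      smult = (\<lambda>c X. \<Union>v\<in>X. U +>\<^bsub>V\<^esub> (c \<odot>\<^bsub>V\<^esub> v))\<rparr>"

definition quot_pmod :: "('p, 'k, 'v) pmod \<Rightarrow> ('p \<Rightarrow> 'v set) \<Rightarrow> ('p, 'k, 'v set) pmod" where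
  "quot_pmod M U =
     \<lparr>ob = (\<lambda>x. quot_space (ob M x) (U x)),
      mor = (\<lambda>y x X. \<Union>v\<in>X. U y +>\<^bsub>ob M y\<^esub> (mor M y x v))\<rparr>"

definition direct_summand :: "'k ring \<Rightarrow> ('p::order, 'k, 'v) pmod \<Rightarrow> ('p \<Rightarrow> 'v set) \<Rightarrow> bool" where
  "direct_summand K M U \<longleftrightarrow>
     submod K M U \<and>
     (\<exists>W. submod K M W \<and>
        (\<forall>x. U x \<inter> W x = {\<zero>\<^bsub>ob M x\<^esub>} \<and> U x <+>\<^bsub>ob M x\<^esub> W x = carrier (ob M x)))"

definition iso_to_direct_summand ::
    "'k ring \<Rightarrow> ('p::order, 'k, 'v) pmod \<Rightarrow> ('p, 'k, 'w) pmod \<Rightarrow> bool" where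
  "iso_to_direct_summand K N M \<longleftrightarrow> (\<exists>U. direct_summand K M U \<and> pmod_iso K N (sub_pmod M U))"

definition interval_pmod :: "'k ring \<Rightarrow> 'p set \<Rightarrow> ('p, 'k, 'k) pmod" where
  "interval_pmod K I =
     \<lparr>ob = (\<lambda>x. \<lparr>carrier = (if x \<in> I then carrier K else {\<zero>\<^bsub>K\<^esub>}),
                  mult = mult K, one = \<one>\<^bsub>K\<^esub>, zero = \<zero>\<^bsub>K\<^esub>, add = add K, smult = mult K\<rparr>),
      mor = (\<lambda>y x v. if x \<in> I \<and> y \<in> I then v else \<zero>\<^bsub>K\<^esub>)\<rparr>"


section \<open>Top and socle\<close>

definition maximal_submod :: "'k ring \<Rightarrow> ('p::order, 'k, 'v) pmod \<Rightarrow> ('p \<Rightarrow> 'v set) \<Rightarrow> bool" where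
  "maximal_submod K M U \<longleftrightarrow>
     submod K M U \<and> U \<noteq> whole M \<and>
     (\<forall>W. submod K M W \<and> U \<le> W \<longrightarrow> W = U \<or> W = whole M)"

definition simple_submod :: "'k ring \<Rightarrow> ('p::order, 'k, 'v) pmod \<Rightarrow> ('p \<Rightarrow> 'v set) \<Rightarrow> bool" where
  "simple_submod K M U \<longleftrightarrow>
     submod K M U \<and> U \<noteq> null M \<and>
     (\<forall>W. submod K M W \<and> W \<le> U \<longrightarrow> W = U \<or> W = null M)"

text \<open>The radical is the intersection of all maximal submodules, the socle the sum of all simple
  submodules.\<close>

definition rad :: "'k ring \<Rightarrow> ('p::order, 'k, 'v) pmod \<Rightarrow> 'p \<Rightarrow> 'v set" where
  "rad K M = (\<lambda>x. {v \<in> carrier (ob M x). \<forall>U. maximal_submod K M U \<longrightarrow> v \<in> U x})"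

definition top_pmod :: "'k ring \<Rightarrow> ('p::order, 'k, 'v) pmod \<Rightarrow> ('p, 'k, 'v set) pmod" where
  "top_pmod K M = quot_pmod M (rad K M)"

definition soc_pmod :: "'k ring \<Rightarrow> ('p::order, 'k, 'v) pmod \<Rightarrow> ('p, 'k, 'v) pmod" where
  "soc_pmod K M = sub_pmod M (\<lambda>x. module.span K (ob M x) (\<Union>{U x | U. simple_submod K M U}))"


section \<open>Minimal projective resolutions and minimal injective coresolutions\<close>

text \<open>
  HOL cannot quantify over all carrier types inside a formula. The test objects below have carriers
  in \<open>nat \<Rightarrow> 'k\<close>; as this type contains a copy of \<open>K\<^sup>n\<close> for every \<open>n\<close>, every finite-dimensional
  module over \<open>K\<close> is isomorphic to one of them.
\<close>

definition projective :: "'k ring \<Rightarrow> ('p::order, 'k, 'v) pmod \<Rightarrow> bool" where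
  "projective K P \<longleftrightarrow> pmodule K P \<and>
     (\<forall>(N :: ('p, 'k, nat \<Rightarrow> 'k) pmod) (N' :: ('p, 'k, nat \<Rightarrow> 'k) pmod) g f.
        pmodule K N \<and> pmodule K N' \<and> pmod_hom K N N' g \<and> pmod_epi N N' g \<and> pmod_hom K P N' f \<longrightarrow>
        (\<exists>h. pmod_hom K P N h \<and> (\<forall>x. \<forall>v\<in>carrier (ob P x). g x (h x v) = f x v)))"

definition injective :: "'k ring \<Rightarrow> ('p::order, 'k, 'v) pmod \<Rightarrow> bool" where
  "injective K Q \<longleftrightarrow> pmodule K Q \<and>
     (\<forall>(N :: ('p, 'k, nat \<Rightarrow> 'k) pmod) (N' :: ('p, 'k, nat \<Rightarrow> 'k) pmod) g f.
        pmodule K N \<and> pmodule K N' \<and> pmod_hom K N N' g \<and> pmod_mono N g \<and> pmod_hom K N Q f \<longrightarrow>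
        (\<exists>h. pmod_hom K N' Q h \<and> (\<forall>x. \<forall>v\<in>carrier (ob N x). h x (g x v) = f x v)))"

definition superfluous :: "'k ring \<Rightarrow> ('p::order, 'k, 'v) pmod \<Rightarrow> ('p \<Rightarrow> 'v set) \<Rightarrow> bool" where
  "superfluous K M U \<longleftrightarrow> submod K M U \<and>
     (\<forall>W. submod K M W \<and> (\<lambda>x. U x <+>\<^bsub>ob M x\<^esub> W x) = whole M \<longrightarrow> W = whole M)"

definition essential :: "'k ring \<Rightarrow> ('p::order, 'k, 'v) pmod \<Rightarrow> ('p \<Rightarrow> 'v set) \<Rightarrow> bool" where
  "essential K M U \<longleftrightarrow> submod K M U \<and>
     (\<forall>W. submod K M W \<and> (\<lambda>x. U x \<inter> W x) = null M \<longrightarrow> W = null M)"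

text \<open>
  An exact sequence \<open>\<dots> \<rightarrow> P 1 \<rightarrow> P 0 \<rightarrow> M \<rightarrow> 0\<close> of projectives with augmentation \<open>\<epsilon>\<close> and
  differentials \<open>d n\<close> from \<open>P (n + 1)\<close> to \<open>P n\<close>. Minimality: each map is a projective cover of its
  image, i.e. has superfluous kernel. Dually, the coresolution \<open>0 \<rightarrow> M \<rightarrow> Q 0 \<rightarrow> Q 1 \<rightarrow> \<dots>\<close> has
  differentials \<open>d n\<close> from \<open>Q n\<close> to \<open>Q (n + 1)\<close>, and each term is an injective envelope of the image
  of the incoming map.
\<close>

definition min_proj_resolution ::
    "'k ring \<Rightarrow> ('p::order, 'k, 'v) pmod \<Rightarrow> (nat \<Rightarrow> ('p, 'k, 'w) pmod) \<Rightarrow>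
     ('p \<Rightarrow> 'w \<Rightarrow> 'v) \<Rightarrow> (nat \<Rightarrow> 'p \<Rightarrow> 'w \<Rightarrow> 'w) \<Rightarrow> bool" where
  "min_proj_resolution K M P \<epsilon> d \<longleftrightarrow>
     (\<forall>n. projective K (P n)) \<and>
     pmod_hom K (P 0) M \<epsilon> \<and> (\<forall>n. pmod_hom K (P (Suc n)) (P n) (d n)) \<and>
     pmod_epi (P 0) M \<epsilon> \<and>
     pmod_im (P 1) (d 0) = pmod_ker (P 0) M \<epsilon> \<and>
     (\<forall>n. pmod_im (P (Suc (Suc n))) (d (Suc n)) = pmod_ker (P (Suc n)) (P n) (d n)) \<and>
     superfluous K (P 0) (pmod_ker (P 0) M \<epsilon>) \<and>
     (\<forall>n. superfluous K (P (Suc n)) (pmod_ker (P (Suc n)) (P n) (d n)))"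

definition min_inj_coresolution ::
    "'k ring \<Rightarrow> ('p::order, 'k, 'v) pmod \<Rightarrow> (nat \<Rightarrow> ('p, 'k, 'w) pmod) \<Rightarrow>
     ('p \<Rightarrow> 'v \<Rightarrow> 'w) \<Rightarrow> (nat \<Rightarrow> 'p \<Rightarrow> 'w \<Rightarrow> 'w) \<Rightarrow> bool" where
  "min_inj_coresolution K M Q \<eta> d \<longleftrightarrow>
     (\<forall>n. injective K (Q n)) \<and>
     pmod_hom K M (Q 0) \<eta> \<and> (\<forall>n. pmod_hom K (Q n) (Q (Suc n)) (d n)) \<and>
     pmod_mono M \<eta> \<and>
     pmod_im M \<eta> = pmod_ker (Q 0) (Q 1) (d 0) \<and>
     (\<forall>n. pmod_im (Q n) (d n) = pmod_ker (Q (Suc n)) (Q (Suc (Suc n))) (d (Suc n))) \<and>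
     essential K (Q 0) (pmod_im M \<eta>) \<and>
     (\<forall>n. essential K (Q (Suc n)) (pmod_im (Q n) (d n)))"


section \<open>The candidate sets\<close>

definition crt0 :: "'k ring \<Rightarrow> ('p::order, 'k, 'v) pmod \<Rightarrow> 'p set set" where
  "crt0 K M = {I \<in> intervals. sc I \<subseteq> supp (top_pmod K M) \<and> sk I \<subseteq> supp (soc_pmod K M)}"

text \<open>
  \<open>P\<^sub>1(M)\<close> and \<open>Q\<^sup>1(M)\<close> are determined by \<open>M\<close> only up to isomorphism; they are passed as the arguments
  \<open>P1\<close> and \<open>Q1\<close>, to be instantiated with the degree-1 terms of an arbitrary minimal projective
  resolution and an arbitrary minimal injective coresolution of \<open>M\<close>.
\<close>

definition crt1' ::
    "'k ring \<Rightarrow> ('p::order, 'k, 'v) pmod \<Rightarrow> ('p, 'k, 'u) pmod \<Rightarrow> ('p, 'k, 'w) pmod \<Rightarrow> 'p set set" where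
  "crt1' K M P1 Q1 =
     {I \<in> crt0 K M. sc (strict_upset I) \<subseteq> supp (top_pmod K P1) \<and>
                    sk (strict_downset I) \<subseteq> supp (soc_pmod K Q1)}"

definition crt_zp :: "('p::order, 'k, 'v) pmod \<Rightarrow> 'p set set" where
  "crt_zp M = {I \<in> intervals. \<forall>a\<in>sc I. \<forall>b\<in>sk I. a \<le> b \<longrightarrow>
                 (\<exists>v\<in>carrier (ob M a). mor M b a v \<noteq> \<zero>\<^bsub>ob M b\<^esub>)}"

definition crt1zp' ::
    "'k ring \<Rightarrow> ('p::order, 'k, 'v) pmod \<Rightarrow> ('p, 'k, 'u) pmod \<Rightarrow> ('p, 'k, 'w) pmod \<Rightarrow> 'p set set" where
  "crt1zp' K M P1 Q1 = crt1' K M P1 Q1 \<inter> crt_zp M"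

end

theory Submission
  imports Defs
begin

section \<open>Linear maps and subspaces\<close>

text \<open>A summand isomorphic to V_I gives maps i : V_I -> M and r : M -> V_I with r i = id
  (\<open>ex_interval_retract\<close>), and every condition is read off from i and r. Two criteria
  turn the conditions into statements about elements. A point c supports the top of N as soon as
  some linear map of rank one on N(c) kills everything arriving from strictly below c, i.e. N has
  the simple module S_c as a quotient (\<open>mem_supp_top_pmodI\<close>). It supports the socle as
  soon as some nonzero element of N(c) dies at every point strictly above c
  (\<open>mem_supp_soc_pmodI\<close>).

  For M itself, r at a minimal point of I and i(1) at a maximal point of I meet these criteria, and
  M_{b,a} sends i_a(1) to i_b(1), which is nonzero.

  For P1, let c be minimal strictly above I. The module V_J on J = I + {c} is a nonsplit extension
  of V_I by S_c. Lift P0 -> M -> V_I to P0 -> V_J and compose with P1 -> P0: the result vanishes on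
  I, so it lands in S_c. It is nonzero: choose a in I below c and an element of P0(a) over i_a(1).
  Transported to c it lies in the kernel of P0 -> M, since V_I(c) = 0, so it comes from P1; but the
  lift sends it to 1. The condition on Q1 is dual: V_I -> M -> Q0 extends to V_J, and the image of 1
  at c gives an element of Q1(c) that is nonzero because r exists.\<close>

lemma (in abelian_group) diff_eq_diff_if_add_eq_add:
  assumes "a \<oplus> b = c \<oplus> d"
    and "a \<in> carrier G" "b \<in> carrier G" "c \<in> carrier G" "d \<in> carrier G"
  shows "a \<ominus> c = d \<ominus> b"
proof -
  have "a \<ominus> c = (a \<oplus> b) \<oplus> (\<ominus> b \<oplus> \<ominus> c)"
    using assms(2-) by (simp add: minus_eq a_assoc r_neg2)
  also have "\<dots> = d \<ominus> b"
    unfolding assms(1) using assms(2-)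
    by (simp add: minus_eq a_comm[of "\<ominus> b" "\<ominus> c"] a_comm[of c d])
       (simp add: a_assoc r_neg2)
  finally show ?thesis .
qed

lemma linear_mapI:
  assumes "vectorspace K V" "vectorspace K W"
    and "\<And>v. v \<in> carrier V \<Longrightarrow> f v \<in> carrier W"
    and "\<And>v w. v \<in> carrier V \<Longrightarrow> w \<in> carrier V \<Longrightarrow> f (v \<oplus>\<^bsub>V\<^esub> w) = f v \<oplus>\<^bsub>W\<^esub> f w"
    and "\<And>k v. k \<in> carrier K \<Longrightarrow> v \<in> carrier V \<Longrightarrow> f (k \<odot>\<^bsub>V\<^esub> v) = k \<odot>\<^bsub>W\<^esub> f v"
  shows "linear_map K V W f"
  using assms unfolding linear_map_def mod_hom_def mod_hom_axioms_def module_hom_def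
    vectorspace_def by auto

lemma linear_mapD:
  assumes "linear_map K V W f"
  shows "vectorspace K V" "vectorspace K W"
    and "v \<in> carrier V \<Longrightarrow> f v \<in> carrier W"
    and "v \<in> carrier V \<Longrightarrow> w \<in> carrier V \<Longrightarrow> f (v \<oplus>\<^bsub>V\<^esub> w) = f v \<oplus>\<^bsub>W\<^esub> f w"
    and "k \<in> carrier K \<Longrightarrow> v \<in> carrier V \<Longrightarrow> f (k \<odot>\<^bsub>V\<^esub> v) = k \<odot>\<^bsub>W\<^esub> f v"
    and "f \<zero>\<^bsub>V\<^esub> = \<zero>\<^bsub>W\<^esub>"
proof -
  interpret linear_map K V W f by fact
  show "vectorspace K V" "vectorspace K W" by unfold_locales
  show "v \<in> carrier V \<Longrightarrow> f v \<in> carrier W" by simp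
  show "v \<in> carrier V \<Longrightarrow> w \<in> carrier V \<Longrightarrow> f (v \<oplus>\<^bsub>V\<^esub> w) = f v \<oplus>\<^bsub>W\<^esub> f w" by simp
  show "k \<in> carrier K \<Longrightarrow> v \<in> carrier V \<Longrightarrow> f (k \<odot>\<^bsub>V\<^esub> v) = k \<odot>\<^bsub>W\<^esub> f v" by simp
  show "f \<zero>\<^bsub>V\<^esub> = \<zero>\<^bsub>W\<^esub>" by simp
qed

lemma subspaceI:
  assumes "vectorspace K V" "S \<subseteq> carrier V" "\<zero>\<^bsub>V\<^esub> \<in> S"
    and "\<And>v w. v \<in> S \<Longrightarrow> w \<in> S \<Longrightarrow> v \<oplus>\<^bsub>V\<^esub> w \<in> S"
    and "\<And>k v. k \<in> carrier K \<Longrightarrow> v \<in> S \<Longrightarrow> k \<odot>\<^bsub>V\<^esub> v \<in> S"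
  shows "subspace K S V"
  using assms unfolding subspace_def submodule_def vectorspace_def by auto

lemma subspaceD:
  assumes "subspace K S V"
  shows "vectorspace K V" "S \<subseteq> carrier V" "\<zero>\<^bsub>V\<^esub> \<in> S"
    and "v \<in> S \<Longrightarrow> w \<in> S \<Longrightarrow> v \<oplus>\<^bsub>V\<^esub> w \<in> S"
    and "k \<in> carrier K \<Longrightarrow> v \<in> S \<Longrightarrow> k \<odot>\<^bsub>V\<^esub> v \<in> S"
  using assms unfolding subspace_def submodule_def by auto

lemma subspace_minus:
  assumes "subspace K S V" "v \<in> S" "w \<in> S"
  shows "v \<ominus>\<^bsub>V\<^esub> w \<in> S"
proof -
  interpret vectorspace K V using subspaceD(1)[OF assms(1)] .
  have "w \<in> carrier V" using assms subspaceD(2) by blast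
  then have "\<ominus>\<^bsub>V\<^esub> w = (\<ominus>\<^bsub>K\<^esub> \<one>\<^bsub>K\<^esub>) \<odot>\<^bsub>V\<^esub> w" by (simp add: smult_l_minus)
  then have "\<ominus>\<^bsub>V\<^esub> w \<in> S" using subspaceD(5)[OF assms(1) _ assms(3)] by simp
  then show ?thesis unfolding a_minus_def using subspaceD(4)[OF assms(1,2)] by simp
qed

lemma submodD:
  assumes "submod K M U"
  shows "subspace K (U x) (ob M x)" "x \<le> y \<Longrightarrow> v \<in> U x \<Longrightarrow> mor M y x v \<in> U y"
  using assms unfolding submod_def by blast+

lemma pmoduleD:
  assumes "pmodule K M"
  shows "vectorspace K (ob M x)"
    and "x \<le> y \<Longrightarrow> linear_map K (ob M x) (ob M y) (mor M y x)"
    and "v \<in> carrier (ob M x) \<Longrightarrow> mor M x x v = v"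
    and "x \<le> y \<Longrightarrow> v \<in> carrier (ob M x) \<Longrightarrow> mor M y x v \<in> carrier (ob M y)"
proof -
  note M = assms[unfolded pmodule_def]
  show "vectorspace K (ob M x)"
    using conjunct1[OF M] by blast
  show *: "linear_map K (ob M x) (ob M y) (mor M y x)" if "x \<le> y"
    using conjunct1[OF conjunct2[OF M]] that by blast
  show "mor M x x v = v" if "v \<in> carrier (ob M x)"
    using conjunct1[OF conjunct2[OF conjunct2[OF M]]] that by blast
  show "mor M y x v \<in> carrier (ob M y)" if "x \<le> y" "v \<in> carrier (ob M x)"
    using linear_mapD(3)[OF *] that by blast
qed

lemma pmod_homD:
  assumes "pmod_hom K M N f"
  shows "linear_map K (ob M x) (ob N x) (f x)"
    and "x \<le> y \<Longrightarrow> v \<in> carrier (ob M x) \<Longrightarrow> f y (mor M y x v) = mor N y x (f x v)"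
    and "v \<in> carrier (ob M x) \<Longrightarrow> f x v \<in> carrier (ob N x)"
    and "f x \<zero>\<^bsub>ob M x\<^esub> = \<zero>\<^bsub>ob N x\<^esub>"
  using assms linear_mapD(3,6)[of K "ob M x" "ob N x" "f x"] unfolding pmod_hom_def by blast+

lemma pmod_hom_comp:
  assumes f: "pmod_hom K L M f" and g: "pmod_hom K M N g"
  shows "pmod_hom K L N (\<lambda>x v. g x (f x v))"
  unfolding pmod_hom_def
proof (intro conjI allI impI ballI)
  fix x
  show "linear_map K (ob L x) (ob N x) (\<lambda>v. g x (f x v))"
    using linear_mapD[OF pmod_homD(1)[OF f, of x]] linear_mapD[OF pmod_homD(1)[OF g, of x]]
    by (intro linear_mapI) auto
next
  fix x y v assume "x \<le> y" "v \<in> carrier (ob L x)"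
  then show "g y (f y (mor L y x v)) = mor N y x (g x (f x v))"
    using pmod_homD(2,3)[OF f] pmod_homD(2)[OF g] by metis
qed

section \<open>Direct summands as retracts\<close>

text \<open>The retraction is the projection onto \<open>U\<close> along a complement
  \<open>W\<close>, followed by the inverse of the isomorphism. \<open>N\<close> is not assumed to
  be a \<open>pmodule\<close>; the assumption \<open>closed\<close> supplies the one fact about its
  structure maps that naturality of the retraction requires.\<close>

lemma ex_retraction_if_iso_to_direct_summand:
  assumes M: "pmodule K M" and iso: "iso_to_direct_summand K N M"
    and closed: "\<And>x y v. x \<le> y \<Longrightarrow> v \<in> carrier (ob N x) \<Longrightarrow> mor N y x v \<in> carrier (ob N y)"
  obtains i r where "pmod_hom K N M i" "pmod_hom K M N r"
    "\<And>x v. v \<in> carrier (ob N x) \<Longrightarrow> r x (i x v) = v"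
proof -
  obtain U W f where U: "submod K M U" and W: "submod K M W"
    and UW: "\<And>x. U x \<inter> W x = {\<zero>\<^bsub>ob M x\<^esub>}" "\<And>x. U x <+>\<^bsub>ob M x\<^esub> W x = carrier (ob M x)"
    and f: "pmod_hom K N (sub_pmod M U) f"
    and bij: "\<And>x. bij_betw (f x) (carrier (ob N x)) (U x)"
    using iso unfolding iso_to_direct_summand_def direct_summand_def pmod_iso_def sub_pmod_def
    by auto
  note sU = submodD[OF U] and sW = submodD[OF W]
  have fl: "linear_map K (ob N x) (ob M x \<lparr>carrier := U x\<rparr>) (f x)" for x
    using pmod_homD(1)[OF f, of x] by (simp add: sub_pmod_def)
  have fU: "f x v \<in> U x" if "v \<in> carrier (ob N x)" for x v
    using linear_mapD(3)[OF fl that] by simp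
  have UM: "v \<in> carrier (ob M x)" if "v \<in> U x" for x v
    using subspaceD(2)[OF sU(1)] that by blast
  have WM: "v \<in> carrier (ob M x)" if "v \<in> W x" for x v
    using subspaceD(2)[OF sW(1)] that by blast
  have N: "vectorspace K (ob N x)" for x using linear_mapD(1)[OF fl] .
  have f_add: "f x (v \<oplus>\<^bsub>ob N x\<^esub> w) = f x v \<oplus>\<^bsub>ob M x\<^esub> f x w"
    if "v \<in> carrier (ob N x)" "w \<in> carrier (ob N x)" for x v w
    using linear_mapD(4)[OF fl that] by simp
  have f_smult: "f x (k \<odot>\<^bsub>ob N x\<^esub> v) = k \<odot>\<^bsub>ob M x\<^esub> f x v"
    if "k \<in> carrier K" "v \<in> carrier (ob N x)" for x k v
    using linear_mapD(5)[OF fl that] by simp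
  have f_mor: "f y (mor N y x v) = mor M y x (f x v)" if "x \<le> y" "v \<in> carrier (ob N x)" for x y v
    using pmod_homD(2)[OF f that] by (simp add: sub_pmod_def)
  have i: "pmod_hom K N M f"
    unfolding pmod_hom_def using N pmoduleD(1)[OF M] fU UM f_add f_smult f_mor
    by (auto intro!: linear_mapI)

  \<comment> \<open>\<open>R x m k\<close> says that k is the coordinate of m in the decomposition
    of M(x) as f(N(x)) + W(x). Once it is known to be single-valued, additivity, homogeneity and
    naturality of r each follow by exhibiting one decomposition.\<close>
  define R where "R x m k \<longleftrightarrow> k \<in> carrier (ob N x) \<and> (\<exists>w\<in>W x. m = f x k \<oplus>\<^bsub>ob M x\<^esub> w)" for x m k
  have RD: "k \<in> carrier (ob N x)" "\<exists>w\<in>W x. m = f x k \<oplus>\<^bsub>ob M x\<^esub> w" if "R x m k" for x m k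
    using that unfolding R_def by (rule conjunct1, rule conjunct2)
  have ex: "\<exists>k. R x m k" if "m \<in> carrier (ob M x)" for x m
  proof -
    have "m \<in> U x <+>\<^bsub>ob M x\<^esub> W x" using UW that by simp
    then obtain u w where "u \<in> U x" "w \<in> W x" "m = u \<oplus>\<^bsub>ob M x\<^esub> w"
      unfolding set_add_def' by auto
    moreover from this have "u \<in> f x ` carrier (ob N x)"
      using bij_betw_imp_surj_on[OF bij] by simp
    ultimately show ?thesis unfolding R_def by blast
  qed
  have uniq: "k = k'" if "R x m k" "R x m k'" for x m k k'
  proof -
    interpret vectorspace K "ob M x" using pmoduleD(1)[OF M] .
    obtain w w' where w: "k \<in> carrier (ob N x)" "k' \<in> carrier (ob N x)" "w \<in> W x" "w' \<in> W x"
      "f x k \<oplus>\<^bsub>ob M x\<^esub> w = f x k' \<oplus>\<^bsub>ob M x\<^esub> w'"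
    proof -
      obtain w where w: "w \<in> W x" "m = f x k \<oplus>\<^bsub>ob M x\<^esub> w"
        using RD(2)[OF \<open>R x m k\<close>] by (elim bexE)
      obtain w' where w': "w' \<in> W x" "m = f x k' \<oplus>\<^bsub>ob M x\<^esub> w'"
        using RD(2)[OF \<open>R x m k'\<close>] by (elim bexE)
      show thesis
        using RD(1)[OF \<open>R x m k\<close>] RD(1)[OF \<open>R x m k'\<close>] w(1) w'(1) trans[OF w(2)[symmetric] w'(2)]
        by (rule that)
    qed
    have c: "f x k \<in> carrier (ob M x)" "f x k' \<in> carrier (ob M x)"
      "w \<in> carrier (ob M x)" "w' \<in> carrier (ob M x)"
      using UM[OF fU[OF w(1)]] UM[OF fU[OF w(2)]] WM[OF w(3)] WM[OF w(4)] .
    \<comment> \<open>Two decompositions of the same vector differ by an element of both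
      \<open>U x\<close> and \<open>W x\<close>, hence by zero.\<close>
    have "f x k \<ominus>\<^bsub>ob M x\<^esub> f x k' = w' \<ominus>\<^bsub>ob M x\<^esub> w"
      using M.diff_eq_diff_if_add_eq_add[OF w(5)] c by blast
    then have "f x k \<ominus>\<^bsub>ob M x\<^esub> f x k' \<in> U x \<inter> W x"
      using subspace_minus[OF sU(1) fU[OF w(1)] fU[OF w(2)]]
        subspace_minus[OF sW(1) w(4) w(3)] by simp
    then have "f x k \<ominus>\<^bsub>ob M x\<^esub> f x k' = \<zero>\<^bsub>ob M x\<^esub>" using UW by auto
    then have "f x k = f x k'" using c by simp
    then show ?thesis using bij[of x] w unfolding bij_betw_def inj_on_def by auto
  qed
  define r where "r x m = (SOME k. R x m k)" for x m
  have r: "R x m (r x m)" if "m \<in> carrier (ob M x)" for x m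
    unfolding r_def by (rule someI_ex[OF ex[OF that]])
  have hom: "pmod_hom K M N r"
    unfolding pmod_hom_def
  proof (intro conjI allI impI ballI linear_mapI)
    fix x
    show "vectorspace K (ob M x)" "vectorspace K (ob N x)" using pmoduleD(1)[OF M] N by this+
    fix v assume v: "v \<in> carrier (ob M x)"
    show "r x v \<in> carrier (ob N x)" using RD(1)[OF r[OF v]] .
    interpret Mx: vectorspace K "ob M x" using pmoduleD(1)[OF M] .
    interpret Nx: vectorspace K "ob N x" using N .
    have a1: "r x v \<in> carrier (ob N x)" using RD(1)[OF r[OF v]] .
    obtain a where a23: "a \<in> W x" "v = f x (r x v) \<oplus>\<^bsub>ob M x\<^esub> a"
      using RD(2)[OF r[OF v]] by (elim bexE)
    note a = a1 a23
    have ac: "a \<in> carrier (ob M x)" "f x (r x v) \<in> carrier (ob M x)" using WM[OF a(2)] UM[OF fU[OF a(1)]] .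
    {
      fix w assume w: "w \<in> carrier (ob M x)"
      have b1: "r x w \<in> carrier (ob N x)" using RD(1)[OF r[OF w]] .
      obtain b where b23: "b \<in> W x" "w = f x (r x w) \<oplus>\<^bsub>ob M x\<^esub> b"
        using RD(2)[OF r[OF w]] by (elim bexE)
      note b = b1 b23
      have bc: "b \<in> carrier (ob M x)" "f x (r x w) \<in> carrier (ob M x)" using WM[OF b(2)] UM[OF fU[OF b(1)]] .
      have "v \<oplus>\<^bsub>ob M x\<^esub> w = (f x (r x v) \<oplus>\<^bsub>ob M x\<^esub> a) \<oplus>\<^bsub>ob M x\<^esub> (f x (r x w) \<oplus>\<^bsub>ob M x\<^esub> b)"
        using arg_cong2[OF a(3) b(3), of "add (ob M x)"] .
      also have "\<dots> = f x (r x v \<oplus>\<^bsub>ob N x\<^esub> r x w) \<oplus>\<^bsub>ob M x\<^esub> (a \<oplus>\<^bsub>ob M x\<^esub> b)"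
        using ac bc by (simp add: f_add[OF a(1) b(1)] Mx.a_ac)
      finally have "R x (v \<oplus>\<^bsub>ob M x\<^esub> w) (r x v \<oplus>\<^bsub>ob N x\<^esub> r x w)"
        unfolding R_def using a(1,2) b(1,2) subspaceD(4)[OF sW(1)] by auto
      then show "r x (v \<oplus>\<^bsub>ob M x\<^esub> w) = r x v \<oplus>\<^bsub>ob N x\<^esub> r x w"
        using uniq r[of "v \<oplus>\<^bsub>ob M x\<^esub> w" x] v w by simp
    }
    {
      fix k assume k: "k \<in> carrier K"
      have "k \<odot>\<^bsub>ob M x\<^esub> v = k \<odot>\<^bsub>ob M x\<^esub> (f x (r x v) \<oplus>\<^bsub>ob M x\<^esub> a)"
        using arg_cong[OF a(3), of "smult (ob M x) k"] .
      also have "\<dots> = f x (k \<odot>\<^bsub>ob N x\<^esub> r x v) \<oplus>\<^bsub>ob M x\<^esub> (k \<odot>\<^bsub>ob M x\<^esub> a)"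
        using ac k by (simp add: f_smult[OF k a(1)] Mx.smult_r_distr)
      finally have "R x (k \<odot>\<^bsub>ob M x\<^esub> v) (k \<odot>\<^bsub>ob N x\<^esub> r x v)"
        unfolding R_def using a(1,2) k subspaceD(5)[OF sW(1)] by auto
      then show "r x (k \<odot>\<^bsub>ob M x\<^esub> v) = k \<odot>\<^bsub>ob N x\<^esub> r x v"
        using uniq r[of "k \<odot>\<^bsub>ob M x\<^esub> v" x] v k by simp
    }
    fix y assume xy: "x \<le> y"
    have "mor M y x v = mor M y x (f x (r x v) \<oplus>\<^bsub>ob M x\<^esub> a)"
      using arg_cong[OF a(3), of "mor M y x"] .
    also have "\<dots> = f y (mor N y x (r x v)) \<oplus>\<^bsub>ob M y\<^esub> mor M y x a"
      using linear_mapD(4)[OF pmoduleD(2)[OF M xy] ac(2,1)] f_mor[OF xy a(1)] by simp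
    finally have eq: "mor M y x v = f y (mor N y x (r x v)) \<oplus>\<^bsub>ob M y\<^esub> mor M y x a" .
    have "R y (mor M y x v) (mor N y x (r x v))"
      unfolding R_def using eq closed[OF xy a(1)] sW(2)[OF xy a(2)] by blast
    then show "r y (mor M y x v) = mor N y x (r x v)"
      using uniq r[OF pmoduleD(4)[OF M xy v]] by blast
  qed
  show thesis
  proof (rule that[OF i hom])
    fix x v assume v: "v \<in> carrier (ob N x)"
    interpret vectorspace K "ob M x" using pmoduleD(1)[OF M] .
    have "f x v \<in> carrier (ob M x)" using UM[OF fU[OF v]] .
    moreover from this have "R x (f x v) v"
      unfolding R_def using v subspaceD(3)[OF sW(1)] by (auto intro!: bexI[of _ "\<zero>\<^bsub>ob M x\<^esub>"])
    ultimately show "r x (f x v) = v" using uniq r by blast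
  qed
qed


section \<open>Detecting the support of the top and the socle\<close>

text \<open>By \<open>below\<close>, g at c and zero elsewhere is a module map from N to a module
  concentrated at c, and by \<open>line\<close> its image is simple. Its kernel is then a maximal
  submodule that misses v, so v is not in the radical.\<close>

lemma mem_supp_top_pmodI:
  fixes N :: "('p::order, 'k, 'v) pmod"
  assumes N: "pmodule K N" and g: "linear_map K (ob N c) L g"
    and v: "v \<in> carrier (ob N c)" "g v \<noteq> \<zero>\<^bsub>L\<^esub>"
    and line: "\<And>w. w \<in> carrier (ob N c) \<Longrightarrow> \<exists>k\<in>carrier K. g w = k \<odot>\<^bsub>L\<^esub> g v"
    and below: "\<And>x w. x < c \<Longrightarrow> w \<in> carrier (ob N x) \<Longrightarrow> g (mor N c x w) = \<zero>\<^bsub>L\<^esub>"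
  shows "c \<in> supp (top_pmod K N)"
proof -
  interpret Nc: vectorspace K "ob N c" using pmoduleD(1)[OF N] .
  interpret L: vectorspace K L using linear_mapD(2)[OF g] .
  note gl = linear_mapD[OF g]
  define X where "X x = (if x = c then {w \<in> carrier (ob N c). g w = \<zero>\<^bsub>L\<^esub>} else carrier (ob N x))"
    for x
  have X: "submod K N X"
    unfolding submod_def
  proof (intro conjI allI impI)
    fix x :: 'p
    interpret Nx: vectorspace K "ob N x" using pmoduleD(1)[OF N] .
    show "subspace K (X x) (ob N x)"
      by (rule subspaceI[OF pmoduleD(1)[OF N]]) (auto simp: X_def gl)
  next
    fix x y :: 'p assume xy: "x \<le> y"
    then show "mor N y x ` X x \<subseteq> X y"
      using below pmoduleD(3,4)[OF N] by (cases "x = y") (auto simp: X_def split: if_splits)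
  qed
  have "maximal_submod K N X"
    unfolding maximal_submod_def
  proof (intro conjI allI impI)
    show "submod K N X" by (fact X)
    have "v \<in> whole N c" "v \<notin> X c" using v by (auto simp: whole_def X_def)
    then show "X \<noteq> whole N" by auto
    fix W assume "submod K N W \<and> X \<le> W"
    then have W: "submod K N W" and XW: "\<And>x. X x \<subseteq> W x" by (auto simp: le_fun_def)
    have WN: "W x \<subseteq> carrier (ob N x)" for x using subspaceD(2)[OF submodD(1)[OF W]] .
    show "W = X \<or> W = whole N"
    proof (rule disjCI)
      assume ne: "W \<noteq> whole N"
      have "w \<in> X c" if w: "w \<in> W c" for w
      proof (rule ccontr)
        assume "w \<notin> X c"
        moreover have wN: "w \<in> carrier (ob N c)" using WN w by blast
        ultimately have gw: "g w \<noteq> \<zero>\<^bsub>L\<^esub>" by (simp add: X_def)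
        obtain k where k: "k \<in> carrier K" "g w = k \<odot>\<^bsub>L\<^esub> g v" using line[OF wN] by blast
        have k0: "k \<noteq> \<zero>\<^bsub>K\<^esub>" using gw k gl(3)[OF v(1)] by auto
        then have kU: "k \<in> Units K" using k(1) by (simp add: Nc.field_Units)
        have "m \<in> W c" if m: "m \<in> carrier (ob N c)" for m
        proof -
          obtain l where l: "l \<in> carrier K" "g m = l \<odot>\<^bsub>L\<^esub> g v" using line[OF m] by blast
          \<comment> \<open>The factor s is chosen so that g(s w) = g(m). Then m - s w lies in the
            kernel of g, hence in W, and so does m: a submodule strictly larger than the kernel is
            everything.\<close>
          define s where "s = l \<otimes>\<^bsub>K\<^esub> inv\<^bsub>K\<^esub> k"
          have s: "s \<in> carrier K" using l kU by (simp add: s_def)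
          have sw: "s \<odot>\<^bsub>ob N c\<^esub> w \<in> W c" using subspaceD(5)[OF submodD(1)[OF W] s w] .
          have "g (s \<odot>\<^bsub>ob N c\<^esub> w) = (s \<otimes>\<^bsub>K\<^esub> k) \<odot>\<^bsub>L\<^esub> g v"
            using gl(5)[OF s wN] s k gl(3)[OF v(1)] by (simp add: L.smult_assoc1)
          also have "s \<otimes>\<^bsub>K\<^esub> k = l" using l kU k by (simp add: s_def Nc.R.m_assoc)
          finally have eq: "g (s \<odot>\<^bsub>ob N c\<^esub> w) = g m" using l by simp
          define z where "z = m \<oplus>\<^bsub>ob N c\<^esub> (\<ominus>\<^bsub>K\<^esub> \<one>\<^bsub>K\<^esub>) \<odot>\<^bsub>ob N c\<^esub> (s \<odot>\<^bsub>ob N c\<^esub> w)"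
          have z: "z \<in> carrier (ob N c)" using m s wN by (simp add: z_def)
          have "g z = g m \<oplus>\<^bsub>L\<^esub> (\<ominus>\<^bsub>K\<^esub> \<one>\<^bsub>K\<^esub>) \<odot>\<^bsub>L\<^esub> g m"
            using m s wN by (simp add: z_def gl(4,5) flip: eq)
          also have "\<dots> = \<zero>\<^bsub>L\<^esub>"
            using gl(3)[OF m] by (simp add: L.smult_l_minus L.M.r_neg)
          finally have "z \<in> W c" using z XW[of c] by (auto simp: X_def)
          then have "z \<oplus>\<^bsub>ob N c\<^esub> s \<odot>\<^bsub>ob N c\<^esub> w \<in> W c"
            using sw subspaceD(4)[OF submodD(1)[OF W]] by blast
          also have "z \<oplus>\<^bsub>ob N c\<^esub> s \<odot>\<^bsub>ob N c\<^esub> w = m"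
            using m s wN by (simp add: z_def Nc.smult_l_minus Nc.M.a_assoc Nc.M.l_neg)
          finally show ?thesis .
        qed
        then have "W x = whole N x" for x
          using XW[of x] WN[of x] by (cases "x = c") (auto simp: X_def whole_def)
        then show False using ne by blast
      qed
      then have "W x = X x" for x
        using XW[of x] WN[of x] by (cases "x = c") (auto simp: X_def)
      then show "W = X" by blast
    qed
  qed
  then have nin: "v \<notin> rad K N c" using v by (auto simp: rad_def X_def)
  \<comment> \<open>The zero of the quotient is the coset \<open>rad K N c\<close> itself, so it
    suffices that the coset of v differs from it. It does, because it contains v.\<close>
  have "\<zero>\<^bsub>ob N c\<^esub> \<in> rad K N c"
    unfolding rad_def maximal_submod_def using subspaceD(3)[OF submodD(1)] by auto
  then have "v \<in> rad K N c +>\<^bsub>ob N c\<^esub> v" using v by (auto simp: a_r_coset_def' intro!: bexI)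
  then have "rad K N c +>\<^bsub>ob N c\<^esub> v \<noteq> rad K N c" using nin by blast
  moreover have "rad K N c +>\<^bsub>ob N c\<^esub> v \<in> a_rcosets\<^bsub>ob N c\<^esub> (rad K N c)"
    using v by (auto simp: A_RCOSETS_def')
  ultimately show ?thesis
    by (auto simp: supp_def top_pmod_def quot_pmod_def quot_space_def)
qed

text \<open>By \<open>above\<close>, the line spanned by t at c, with zero at all other points, is
  closed under the structure maps. Being one-dimensional, it is a simple submodule, so t lies in the
  socle.\<close>

lemma mem_supp_soc_pmodI:
  fixes N :: "('p::order, 'k, 'v) pmod"
  assumes N: "pmodule K N" and t: "t \<in> carrier (ob N c)" "t \<noteq> \<zero>\<^bsub>ob N c\<^esub>"
    and above: "\<And>y. c < y \<Longrightarrow> mor N y c t = \<zero>\<^bsub>ob N y\<^esub>"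
  shows "c \<in> supp (soc_pmod K N)"
proof -
  interpret Nc: vectorspace K "ob N c" using pmoduleD(1)[OF N] .
  define U where "U x = (if x = c then {k \<odot>\<^bsub>ob N c\<^esub> t | k. k \<in> carrier K} else {\<zero>\<^bsub>ob N x\<^esub>})" for x
  have zero: "\<zero>\<^bsub>ob N x\<^esub> \<in> U x" for x
    using t by (auto simp: U_def intro!: exI[of _ "\<zero>\<^bsub>K\<^esub>"])
  have tU: "t \<in> U c"
    using t by (auto simp: U_def intro!: exI[of _ "\<one>\<^bsub>K\<^esub>"])
  have sub: "subspace K (U x) (ob N x)" for x
  proof -
    interpret Nx: vectorspace K "ob N x" using pmoduleD(1)[OF N] .
    show ?thesis
    proof (rule subspaceI[OF pmoduleD(1)[OF N] _ zero])
      show "U x \<subseteq> carrier (ob N x)" using t by (auto simp: U_def)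
      show "v \<oplus>\<^bsub>ob N x\<^esub> w \<in> U x" if "v \<in> U x" "w \<in> U x" for v w
        using that t Nc.smult_l_distr[symmetric] Nc.R.a_closed
        by (fastforce simp: U_def split: if_splits)
      show "k \<odot>\<^bsub>ob N x\<^esub> v \<in> U x" if "k \<in> carrier K" "v \<in> U x" for k v
        using that t Nc.smult_assoc1[symmetric] Nc.R.m_closed
        by (fastforce simp: U_def split: if_splits)
    qed
  qed
  have U: "submod K N U"
    unfolding submod_def
  proof (intro conjI allI impI sub)
    fix x y :: 'p assume xy: "x \<le> y"
    have ml: "linear_map K (ob N x) (ob N y) (mor N y x)" using pmoduleD(2)[OF N xy] .
    show "mor N y x ` U x \<subseteq> U y"
    proof (cases "x = y")
      case True
      then show ?thesis using pmoduleD(3)[OF N] subspaceD(2)[OF sub[of y]] by auto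
    next
      case False
      interpret Ny: vectorspace K "ob N y" using pmoduleD(1)[OF N] .
      have "mor N y x u = \<zero>\<^bsub>ob N y\<^esub>" if "u \<in> U x" for u
        using that t False xy above[of y] linear_mapD(5,6)[OF ml] by (auto simp: U_def split: if_splits)
      then show ?thesis using zero by auto
    qed
  qed
  have "simple_submod K N U"
    unfolding simple_submod_def
  proof (intro conjI allI impI U)
    have "t \<notin> null N c" using t by (simp add: null_def)
    then show "U \<noteq> null N" using tU by auto
    fix W assume "submod K N W \<and> W \<le> U"
    then have W: "submod K N W" and WU: "\<And>x. W x \<subseteq> U x" by (auto simp: le_fun_def)
    have W0: "\<zero>\<^bsub>ob N x\<^esub> \<in> W x" for x using subspaceD(3)[OF submodD(1)[OF W]] .
    show "W = U \<or> W = null N"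
    proof (rule disjCI)
      assume ne: "W \<noteq> null N"
      have "\<exists>w\<in>W c. w \<noteq> \<zero>\<^bsub>ob N c\<^esub>"
      proof (rule ccontr)
        assume "\<not> ?thesis"
        then have "W x \<subseteq> {\<zero>\<^bsub>ob N x\<^esub>}" for x
          using WU[of x] by (cases "x = c") (blast, simp add: U_def)
        then have "W x = null N x" for x
          using W0[of x] unfolding null_def by blast
        then show False using ne by blast
      qed
      then obtain k where k: "k \<in> carrier K" "k \<odot>\<^bsub>ob N c\<^esub> t \<in> W c" "k \<odot>\<^bsub>ob N c\<^esub> t \<noteq> \<zero>\<^bsub>ob N c\<^esub>"
        using WU[of c] by (auto simp: U_def)
      then have "k \<noteq> \<zero>\<^bsub>K\<^esub>" using t by auto
      then have kU: "k \<in> Units K" using k(1) by (simp add: Nc.field_Units)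
      have "l \<odot>\<^bsub>ob N c\<^esub> t \<in> W c" if l: "l \<in> carrier K" for l
      proof -
        have "(l \<otimes>\<^bsub>K\<^esub> inv\<^bsub>K\<^esub> k) \<odot>\<^bsub>ob N c\<^esub> (k \<odot>\<^bsub>ob N c\<^esub> t) \<in> W c"
          using subspaceD(5)[OF submodD(1)[OF W]] k l kU by simp
        also have "(l \<otimes>\<^bsub>K\<^esub> inv\<^bsub>K\<^esub> k) \<odot>\<^bsub>ob N c\<^esub> (k \<odot>\<^bsub>ob N c\<^esub> t) = l \<odot>\<^bsub>ob N c\<^esub> t"
          using k l kU t by (simp add: Nc.smult_assoc1[symmetric] Nc.R.m_assoc)
        finally show ?thesis .
      qed
      then have "U x \<subseteq> W x" for x
        using W0[of x] by (cases "x = c") (auto simp: U_def)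
      then have "W x = U x" for x
        using WU by blast
      then show "W = U" by blast
    qed
  qed
  moreover have "\<Union>{U c | U. simple_submod K N U} \<subseteq> carrier (ob N c)"
    using subspaceD(2)[OF submodD(1)] unfolding simple_submod_def by blast
  ultimately have "t \<in> Nc.span (\<Union>{U c | U. simple_submod K N U})"
    using tU Nc.in_own_span by blast
  then show ?thesis
    using t by (auto simp: supp_def soc_pmod_def sub_pmod_def)
qed


section \<open>Interval modules as test objects\<close>

text \<open>
  A copy of \<open>interval_pmod\<close> with carriers in \<open>nat \<Rightarrow> 'k\<close>, the type over which \<open>projective\<close> and
  \<open>injective\<close> quantify; a scalar is represented by the corresponding constant sequence.
\<close>

definition const_space :: "'k ring \<Rightarrow> 'k set \<Rightarrow> ('k, nat \<Rightarrow> 'k) module" where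
  "const_space K A =
     \<lparr>carrier = (\<lambda>k _. k) ` A, mult = (\<lambda>f g n. f n \<otimes>\<^bsub>K\<^esub> g n), one = (\<lambda>_. \<one>\<^bsub>K\<^esub>),
      zero = (\<lambda>_. \<zero>\<^bsub>K\<^esub>), add = (\<lambda>f g n. f n \<oplus>\<^bsub>K\<^esub> g n), smult = (\<lambda>k f n. k \<otimes>\<^bsub>K\<^esub> f n)\<rparr>"

definition interval_seq :: "'k ring \<Rightarrow> 'p set \<Rightarrow> ('p, 'k, nat \<Rightarrow> 'k) pmod" where
  "interval_seq K I =
     \<lparr>ob = (\<lambda>x. const_space K (if x \<in> I then carrier K else {\<zero>\<^bsub>K\<^esub>})),
      mor = (\<lambda>y x v. if x \<in> I \<and> y \<in> I then v else (\<lambda>_. \<zero>\<^bsub>K\<^esub>))\<rparr>"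

lemma const_space_simps [simp]:
  "carrier (const_space K A) = (\<lambda>k _. k) ` A"
  "\<zero>\<^bsub>const_space K A\<^esub> = (\<lambda>_. \<zero>\<^bsub>K\<^esub>)"
  "f \<oplus>\<^bsub>const_space K A\<^esub> g = (\<lambda>n. f n \<oplus>\<^bsub>K\<^esub> g n)"
  "k \<odot>\<^bsub>const_space K A\<^esub> f = (\<lambda>n. k \<otimes>\<^bsub>K\<^esub> f n)"
  by (simp_all add: const_space_def)

lemma interval_seq_simps [simp]:
  "ob (interval_seq K I) x = const_space K (if x \<in> I then carrier K else {\<zero>\<^bsub>K\<^esub>})"
  "mor (interval_seq K I) y x v = (if x \<in> I \<and> y \<in> I then v else (\<lambda>_. \<zero>\<^bsub>K\<^esub>))"
  by (simp_all add: interval_seq_def)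

lemma interval_pmod_simps [simp]:
  "carrier (ob (interval_pmod K I) x) = (if x \<in> I then carrier K else {\<zero>\<^bsub>K\<^esub>})"
  "\<zero>\<^bsub>ob (interval_pmod K I) x\<^esub> = \<zero>\<^bsub>K\<^esub>"
  "a \<oplus>\<^bsub>ob (interval_pmod K I) x\<^esub> b = a \<oplus>\<^bsub>K\<^esub> b"
  "k \<odot>\<^bsub>ob (interval_pmod K I) x\<^esub> a = k \<otimes>\<^bsub>K\<^esub> a"
  "mor (interval_pmod K I) y x a = (if x \<in> I \<and> y \<in> I then a else \<zero>\<^bsub>K\<^esub>)"
  by (simp_all add: interval_pmod_def)

lemma vectorspace_const_space:
  assumes K: "field K" and A: "A = carrier K \<or> A = {\<zero>\<^bsub>K\<^esub>}"
  shows "vectorspace K (const_space K A)" "vectorspace.fin_dim K (const_space K A)"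
proof -
  interpret K: field K by fact
  have AK: "a \<in> carrier K" if "a \<in> A" for a using A that by auto
  have A0: "\<zero>\<^bsub>K\<^esub> \<in> A" using A by auto
  have Aadd: "a \<oplus>\<^bsub>K\<^esub> b \<in> A" if "a \<in> A" "b \<in> A" for a b using A that by auto
  have Amul: "k \<otimes>\<^bsub>K\<^esub> a \<in> A" if "k \<in> carrier K" "a \<in> A" for k a using A that by auto
  have Aneg: "\<ominus>\<^bsub>K\<^esub> a \<in> A" if "a \<in> A" for a using A that by auto
  have "abelian_group (const_space K A)"
  proof (rule abelian_groupI)
    fix f g h assume "f \<in> carrier (const_space K A)" "g \<in> carrier (const_space K A)"
      "h \<in> carrier (const_space K A)"
    then obtain a b c where abc: "f = (\<lambda>_. a)" "g = (\<lambda>_. b)" "h = (\<lambda>_. c)" "a \<in> A" "b \<in> A" "c \<in> A"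
      by auto
    show "f \<oplus>\<^bsub>const_space K A\<^esub> g \<oplus>\<^bsub>const_space K A\<^esub> h
        = f \<oplus>\<^bsub>const_space K A\<^esub> (g \<oplus>\<^bsub>const_space K A\<^esub> h)"
      using abc AK by (simp add: K.a_assoc)
  next
    fix f g assume "f \<in> carrier (const_space K A)" "g \<in> carrier (const_space K A)"
    then obtain a b where ab: "f = (\<lambda>_. a)" "g = (\<lambda>_. b)" "a \<in> A" "b \<in> A" by auto
    show "f \<oplus>\<^bsub>const_space K A\<^esub> g \<in> carrier (const_space K A)"
      using ab Aadd by auto
    show "f \<oplus>\<^bsub>const_space K A\<^esub> g = g \<oplus>\<^bsub>const_space K A\<^esub> f"
      using ab AK by (simp add: K.a_comm)
  next
    fix f assume "f \<in> carrier (const_space K A)"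
    then obtain a where a: "f = (\<lambda>_. a)" "a \<in> A" by auto
    show "\<zero>\<^bsub>const_space K A\<^esub> \<oplus>\<^bsub>const_space K A\<^esub> f = f"
      using a AK by simp
    show "\<exists>g\<in>carrier (const_space K A). g \<oplus>\<^bsub>const_space K A\<^esub> f = \<zero>\<^bsub>const_space K A\<^esub>"
      using a AK Aneg[OF a(2)] K.l_neg by (auto intro!: bexI[of _ "\<ominus>\<^bsub>K\<^esub> a"])
  qed (use A0 in auto)
  then have "module K (const_space K A)"
    using AK Amul by (intro moduleI K.is_cring) (auto simp: K.l_distr K.r_distr K.m_assoc)
  then show vs: "vectorspace K (const_space K A)"
    using K by (simp add: vectorspace_def)
  interpret V: vectorspace K "const_space K A" by fact
  \<comment> \<open>A spanning vector for both admissible values of \<open>A\<close>: the unit for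
    the full line, zero for the zero space.\<close>
  define e where "e = (if A = carrier K then \<one>\<^bsub>K\<^esub> else \<zero>\<^bsub>K\<^esub>)"
  have e: "(\<lambda>_::nat. e) \<in> carrier (const_space K A)" using A by (auto simp: e_def)
  have "f \<in> V.span {\<lambda>_. e}" if f: "f \<in> carrier (const_space K A)" for f
  proof -
    obtain a where a: "f = (\<lambda>_. a)" "a \<in> A" using f by auto
    have "(\<lambda>_. e) \<in> V.span {\<lambda>_. e}" using V.in_own_span[of "{\<lambda>_. e}"] e by blast
    then have "a \<odot>\<^bsub>const_space K A\<^esub> (\<lambda>_. e) \<in> V.span {\<lambda>_. e}"
      using submodule.smult_closed[OF V.span_is_submodule] e AK[OF a(2)] by blast
    also have "a \<odot>\<^bsub>const_space K A\<^esub> (\<lambda>_. e) = f"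
      using a A AK[OF a(2)] by (auto simp: e_def)
    finally show ?thesis .
  qed
  then have "V.span {\<lambda>_. e} = carrier (const_space K A)"
    using V.span_is_subset2[of "{\<lambda>_. e}"] e by blast
  then show "V.fin_dim" unfolding V.fin_dim_def using e by (intro exI[of _ "{\<lambda>_. e}"]) auto
qed

text \<open>Convexity is exactly functoriality: for x <= y <= z with x and z in I, the direct map is
  the identity, while a detour through a y outside I would be zero.\<close>

lemma pmodule_interval_seq:
  fixes I :: "'p::order set"
  assumes K: "field K" and I: "convex_subset I"
  shows "pmodule K (interval_seq K I)"
proof -
  interpret K: field K by fact
  note vs = vectorspace_const_space[OF K]
  show ?thesis
    unfolding pmodule_def
  proof (intro conjI allI impI ballI)
    fix x y z :: 'p and v
    show "vectorspace K (ob (interval_seq K I) x)" using vs(1) by simp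
    show "vectorspace.fin_dim K (ob (interval_seq K I) x)" using vs(2) by simp
    show "linear_map K (ob (interval_seq K I) x) (ob (interval_seq K I) y)
        (mor (interval_seq K I) y x)"
      by (rule linear_mapI) (use vs(1) in auto)
    show "mor (interval_seq K I) x x v = v" if "v \<in> carrier (ob (interval_seq K I) x)"
      using that by (auto split: if_splits)
    assume "x \<le> y" "y \<le> z"
    then have "x \<in> I \<Longrightarrow> z \<in> I \<Longrightarrow> y \<in> I"
      using I unfolding convex_subset_def by blast
    then show "mor (interval_seq K I) z x v
        = mor (interval_seq K I) z y (mor (interval_seq K I) y x v)"
      by auto
  qed
qed

section \<open>Interval modules as retracts of M, and the conditions on M itself\<close>

text \<open>The summand hypothesis in the form used below. V_I appears as
  \<open>interval_seq\<close>, so that i and r can be composed with the lifting properties in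
  \<open>projective\<close> and \<open>injective\<close>.\<close>

locale interval_retract =
  fixes K :: "'k ring" and M :: "('p::order, 'k, 'v) pmod" and I :: "'p set" and i r
  assumes K: "field K" and M: "pmodule K M" and I: "convex_subset I"
    and i: "pmod_hom K (interval_seq K I) M i" and r: "pmod_hom K M (interval_seq K I) r"
    and r_i: "\<And>x v. v \<in> carrier (ob (interval_seq K I) x) \<Longrightarrow> r x (i x v) = v"

lemma ex_interval_retract:
  assumes K: "field K" and M: "pmodule K M" and I: "convex_subset I"
    and iso: "iso_to_direct_summand K (interval_pmod K I) M"
  shows "\<exists>i r. interval_retract K M I i r"
proof -
  interpret K: field K by fact
  have closed: "mor (interval_pmod K I) y x v \<in> carrier (ob (interval_pmod K I) y)"
    if "x \<le> y" "v \<in> carrier (ob (interval_pmod K I) x)" for x y v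
    using that by (auto split: if_splits)
  obtain i r where i: "pmod_hom K (interval_pmod K I) M i" and r: "pmod_hom K M (interval_pmod K I) r"
    and r_i: "\<And>x v. v \<in> carrier (ob (interval_pmod K I) x) \<Longrightarrow> r x (i x v) = v"
    by (rule ex_retraction_if_iso_to_direct_summand[OF M iso closed]) (assumption | rule that)+
  \<comment> \<open>That \<open>interval_pmod\<close> consists of vector spaces is read off from the
    linearity of i.\<close>
  have vs: "vectorspace K (ob (interval_pmod K I) x)" for x
    using linear_mapD(1)[OF pmod_homD(1)[OF i]] .
  have vs': "vectorspace K (ob (interval_seq K I) x)" for x
    using pmoduleD(1)[OF pmodule_interval_seq[OF K I]] .
  \<comment> \<open>Evaluation at 0 is inverse to forming constant sequences, so i and r transfer
    between the two copies of V_I.\<close>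
  have "linear_map K (ob (interval_seq K I) x) (ob (interval_pmod K I) x) (\<lambda>v. v 0)" for x
    by (rule linear_mapI[OF vs' vs]) (auto split: if_splits)
  then have "pmod_hom K (interval_seq K I) (interval_pmod K I) (\<lambda>_ v. v 0)"
    unfolding pmod_hom_def by auto
  then have i': "pmod_hom K (interval_seq K I) M (\<lambda>x v. i x (v 0))"
    using pmod_hom_comp i by blast
  have "linear_map K (ob (interval_pmod K I) x) (ob (interval_seq K I) x) (\<lambda>a _. a)" for x
    by (rule linear_mapI[OF vs vs']) (auto split: if_splits)
  then have "pmod_hom K (interval_pmod K I) (interval_seq K I) (\<lambda>_ a _. a)"
    unfolding pmod_hom_def by auto
  then have "pmod_hom K M (interval_seq K I) (\<lambda>x m _. r x m)"
    using pmod_hom_comp[OF r] by blast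
  then have "interval_retract K M I (\<lambda>x v. i x (v 0)) (\<lambda>x m _. r x m)"
    using i' r_i by unfold_locales (auto simp: K M I)
  then show ?thesis by blast
qed

context interval_retract
begin

interpretation K: field K by (fact K)

lemma r_i_one: "x \<in> I \<Longrightarrow> r x (i x (\<lambda>_. \<one>\<^bsub>K\<^esub>)) = (\<lambda>_. \<one>\<^bsub>K\<^esub>)"
  by (rule r_i) auto

lemma i_one_closed: "x \<in> I \<Longrightarrow> i x (\<lambda>_. \<one>\<^bsub>K\<^esub>) \<in> carrier (ob M x)"
  by (rule pmod_homD(3)[OF i]) auto

lemma i_one_nonzero: "x \<in> I \<Longrightarrow> i x (\<lambda>_. \<one>\<^bsub>K\<^esub>) \<noteq> \<zero>\<^bsub>ob M x\<^esub>"
  using r_i_one[of x] pmod_homD(4)[OF r, of x] by (auto dest: fun_cong)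

lemma mor_i_one:
  assumes "x \<in> I" "x \<le> y"
  shows "mor M y x (i x (\<lambda>_. \<one>\<^bsub>K\<^esub>)) = (if y \<in> I then i y (\<lambda>_. \<one>\<^bsub>K\<^esub>) else \<zero>\<^bsub>ob M y\<^esub>)"
  using pmod_homD(2)[OF i assms(2), of "\<lambda>_. \<one>\<^bsub>K\<^esub>"] pmod_homD(4)[OF i, of y] assms(1) by auto

text \<open>The functional is r at a. Points x below a minimal a are outside I, so by naturality r
  kills what arrives from x, since it passes through V_I(x) = 0.\<close>

lemma sc_subset_supp_top: "sc I \<subseteq> supp (top_pmod K M)"
proof
  fix a assume "a \<in> sc I"
  then have a: "a \<in> I" and min: "\<And>x. x < a \<Longrightarrow> x \<notin> I" unfolding sc_def by auto
  show "a \<in> supp (top_pmod K M)"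
  proof (rule mem_supp_top_pmodI[OF M pmod_homD(1)[OF r] i_one_closed[OF a]])
    show "r a (i a (\<lambda>_. \<one>\<^bsub>K\<^esub>)) \<noteq> \<zero>\<^bsub>ob (interval_seq K I) a\<^esub>"
      using r_i_one[OF a] by (auto dest: fun_cong)
    show "\<exists>k\<in>carrier K. r a w = k \<odot>\<^bsub>ob (interval_seq K I) a\<^esub> r a (i a (\<lambda>_. \<one>\<^bsub>K\<^esub>))"
      if "w \<in> carrier (ob M a)" for w
      using pmod_homD(3)[OF r that] a r_i_one[OF a] by auto
    show "r a (mor M a x w) = \<zero>\<^bsub>ob (interval_seq K I) a\<^esub>"
      if "x < a" "w \<in> carrier (ob M x)" for x w
      using pmod_homD(2)[OF r, of x a w] that min by auto
  qed
qed

text \<open>The element i_b(1) is nonzero because r recovers 1 from it, and it dies above a maximal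
  b because V_I is zero there.\<close>

lemma sk_subset_supp_soc: "sk I \<subseteq> supp (soc_pmod K M)"
proof
  fix b assume "b \<in> sk I"
  then have b: "b \<in> I" and max: "\<And>y. b < y \<Longrightarrow> y \<notin> I" unfolding sk_def by auto
  show "b \<in> supp (soc_pmod K M)"
    using mem_supp_soc_pmodI[OF M i_one_closed[OF b] i_one_nonzero[OF b]] mor_i_one[OF b] max
    by auto
qed

lemma mor_nonzero:
  assumes "a \<in> I" "b \<in> I" "a \<le> b"
  shows "\<exists>v\<in>carrier (ob M a). mor M b a v \<noteq> \<zero>\<^bsub>ob M b\<^esub>"
  using assms i_one_closed mor_i_one i_one_nonzero by metis

section \<open>The top of P1: extending I by a point above it\<close>

text \<open>
  For \<open>c\<close> minimal in \<open>\<Up>I\<close> there is a non-split extension \<open>0 \<rightarrow> S\<^sub>c \<rightarrow> V\<^bsub>I \<union> {c}\<^esub> \<rightarrow> V\<^sub>I \<rightarrow> 0\<close>. Lifting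
  \<open>P\<^sub>0 \<rightarrow> M \<rightarrow> V\<^sub>I\<close> to the middle term and restricting to \<open>P\<^sub>1\<close> yields a nonzero map to \<open>S\<^sub>c\<close>.
\<close>
lemma sc_strict_upset_subset_supp_top:
  assumes P0: "projective K P0" and P1: "pmodule K P1"
    and \<epsilon>: "pmod_hom K P0 M \<epsilon>" "pmod_epi P0 M \<epsilon>"
    and d: "pmod_hom K P1 P0 d" "pmod_im P1 d = pmod_ker P0 M \<epsilon>"
  shows "sc (strict_upset I) \<subseteq> supp (top_pmod K P1)"
proof
  fix c assume c: "c \<in> sc (strict_upset I)"
  then obtain a where a: "a \<in> I" "a \<le> c" and cI: "c \<notin> I"
    unfolding sc_def strict_upset_def upset_def by auto
  have min: "y \<in> I \<or> y = c" if "x \<in> I" "x \<le> y" "y \<le> c" for x y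
    using c that unfolding sc_def strict_upset_def upset_def by blast
  \<comment> \<open>Otherwise a <= c <= y would put c into I by convexity. Thus nothing leads from c
    back into I, which makes S_c a submodule of V_J and \<pi> natural.\<close>
  have above: "y \<notin> I" if "c \<le> y" for y
    using I a cI that unfolding convex_subset_def by blast
  define J where "J = insert c I"
  have "convex_subset J"
    unfolding convex_subset_def
  proof (intro ballI allI impI)
    fix x z y assume xz: "x \<in> J" "z \<in> J" and xyz: "x \<le> y \<and> y \<le> z"
    show "y \<in> J"
    proof (cases "x = c")
      case True
      then have "z = c" using above[of z] order_trans[of x y z] xz xyz J_def by auto
      then show ?thesis using True xyz J_def by auto
    next
      case False
      then have x: "x \<in> I" using xz J_def by auto
      show ?thesis
      proof (cases "z = c")
        case True
        then show ?thesis using min[OF x] xyz J_def by auto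
      next
        case False
        then have "z \<in> I" using xz J_def by auto
        then show ?thesis using I x xyz unfolding convex_subset_def J_def by blast
      qed
    qed
  qed
  then have J: "pmodule K (interval_seq K J)" by (rule pmodule_interval_seq[OF K])
  have V: "pmodule K (interval_seq K I)" by (rule pmodule_interval_seq[OF K I])
  define \<pi> :: "'p \<Rightarrow> (nat \<Rightarrow> 'k) \<Rightarrow> nat \<Rightarrow> 'k" where "\<pi> x v = (if x \<in> I then v else (\<lambda>_. \<zero>\<^bsub>K\<^esub>))" for x v
  have "linear_map K (ob (interval_seq K J) x) (ob (interval_seq K I) x) (\<pi> x)" for x
    by (rule linear_mapI[OF pmoduleD(1)[OF J] pmoduleD(1)[OF V]]) (auto simp: \<pi>_def J_def)
  moreover have "\<pi> y (mor (interval_seq K J) y x v) = mor (interval_seq K I) y x (\<pi> x v)"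
    if "x \<le> y" for x y v
    using above[of y] that by (auto simp: \<pi>_def J_def)
  ultimately have \<pi>: "pmod_hom K (interval_seq K J) (interval_seq K I) \<pi>"
    unfolding pmod_hom_def by blast
  have "pmod_im (interval_seq K J) \<pi> x = whole (interval_seq K I) x" for x
    by (force simp: pmod_im_def whole_def \<pi>_def J_def)
  then have "pmod_epi (interval_seq K J) (interval_seq K I) \<pi>"
    unfolding pmod_epi_def by blast
  moreover have "pmod_hom K P0 (interval_seq K I) (\<lambda>x q. r x (\<epsilon> x q))"
    by (rule pmod_hom_comp[OF \<epsilon>(1) r])
  ultimately have "\<exists>h. pmod_hom K P0 (interval_seq K J) h \<and>
      (\<forall>x. \<forall>q\<in>carrier (ob P0 x). \<pi> x (h x q) = r x (\<epsilon> x q))"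
    using P0 J V \<pi> unfolding projective_def by blast
  then obtain h where h: "pmod_hom K P0 (interval_seq K J) h"
    and \<pi>_h: "\<And>x q. q \<in> carrier (ob P0 x) \<Longrightarrow> \<pi> x (h x q) = r x (\<epsilon> x q)"
    by blast
  \<comment> \<open>Over I the lift is forced to be r \<epsilon>; only its value at c is
    new.\<close>
  have hI: "h x q = r x (\<epsilon> x q)" if "q \<in> carrier (ob P0 x)" "x \<in> I" for x q
    using \<pi>_h[OF that(1)] that(2) by (simp add: \<pi>_def)
  have hd: "pmod_hom K P1 (interval_seq K J) (\<lambda>x v. h x (d x v))"
    by (rule pmod_hom_comp[OF d(1) h])
  have "i a (\<lambda>_. \<one>\<^bsub>K\<^esub>) \<in> pmod_im P0 \<epsilon> a"
    using \<epsilon>(2) i_one_closed[OF a(1)] unfolding pmod_epi_def whole_def by simp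
  then obtain q where q: "q \<in> carrier (ob P0 a)" "\<epsilon> a q = i a (\<lambda>_. \<one>\<^bsub>K\<^esub>)"
    unfolding pmod_im_def by auto
  have P0': "pmodule K P0" using P0 unfolding projective_def by (rule conjunct1)
  \<comment> \<open>By naturality \<epsilon> sends this element to M_{c,a} i_a(1), which is zero
    because c is outside I; exactness then provides a preimage v in P1.\<close>
  have "mor P0 c a q \<in> pmod_ker P0 M \<epsilon> c"
    using pmoduleD(4)[OF P0' a(2) q(1)] pmod_homD(2)[OF \<epsilon>(1) a(2) q(1)] mor_i_one[OF a] cI q(2)
    unfolding pmod_ker_def by simp
  then have "mor P0 c a q \<in> pmod_im P1 d c" using d(2) by simp
  then obtain v where v: "v \<in> carrier (ob P1 c)" "d c v = mor P0 c a q"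
    unfolding pmod_im_def by auto
  \<comment> \<open>Computed along the other side of the square: h sends q to 1 at a, and V_J
    carries 1 from a to c unchanged.\<close>
  have hv: "h c (d c v) = (\<lambda>_. \<one>\<^bsub>K\<^esub>)"
    using pmod_homD(2)[OF h a(2) q(1)] hI[OF q(1) a(1)] a(1) v(2) q(2) r_i_one[OF a(1)]
    by (simp add: J_def)
  show "c \<in> supp (top_pmod K P1)"
  proof (rule mem_supp_top_pmodI[OF P1 pmod_homD(1)[OF hd] v(1)])
    show "h c (d c v) \<noteq> \<zero>\<^bsub>ob (interval_seq K J) c\<^esub>"
      using hv by (auto dest: fun_cong)
    show "\<exists>k\<in>carrier K. h c (d c w) = k \<odot>\<^bsub>ob (interval_seq K J) c\<^esub> h c (d c v)"
      if "w \<in> carrier (ob P1 c)" for w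
      using pmod_homD(3)[OF hd that] hv by (auto simp: J_def)
    show "h c (d c (mor P1 c x w)) = \<zero>\<^bsub>ob (interval_seq K J) c\<^esub>"
      if x: "x < c" and w: "w \<in> carrier (ob P1 x)" for x w
    proof -
      \<comment> \<open>If x is in I, then h d = r \<epsilon> d = 0 there by exactness; otherwise x
        is outside J, as x < c, and the structure map of V_J from x to c is zero.\<close>
      have "d x w \<in> pmod_im P1 d x" using w unfolding pmod_im_def by simp
      then have "d x w \<in> carrier (ob P0 x)" "\<epsilon> x (d x w) = \<zero>\<^bsub>ob M x\<^esub>"
        using d(2) unfolding pmod_ker_def by auto
      then have "h x (d x w) = (\<lambda>_. \<zero>\<^bsub>K\<^esub>)" if "x \<in> I"
        using hI[OF _ that] pmod_homD(4)[OF r, of x] by simp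
      then show ?thesis
        using pmod_homD(2)[OF hd less_imp_le[OF x] w] x by (auto simp: J_def)
    qed
  qed
qed

section \<open>The socle of Q1: extending I by a point below it\<close>

text \<open>
  Dually, for \<open>c\<close> maximal in \<open>\<Down>I\<close> the sequence \<open>0 \<rightarrow> V\<^sub>I \<rightarrow> V\<^bsub>I \<union> {c}\<^esub> \<rightarrow> S\<^sub>c \<rightarrow> 0\<close> does not split, and
  extending \<open>V\<^sub>I \<rightarrow> M \<rightarrow> Q\<^sup>0\<close> to its middle term yields a nonzero map from \<open>S\<^sub>c\<close> to \<open>Q\<^sup>1\<close>.
\<close>
lemma sk_strict_downset_subset_supp_soc:
  assumes Q0: "injective K Q0" and Q1: "pmodule K Q1"
    and \<eta>: "pmod_hom K M Q0 \<eta>" "pmod_mono M \<eta>"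
    and d: "pmod_hom K Q0 Q1 d" "pmod_im M \<eta> = pmod_ker Q0 Q1 d"
  shows "sk (strict_downset I) \<subseteq> supp (soc_pmod K Q1)"
proof
  fix c assume c: "c \<in> sk (strict_downset I)"
  then obtain a where a: "a \<in> I" "c \<le> a" and cI: "c \<notin> I"
    unfolding sk_def strict_downset_def downset_def by auto
  have max: "y \<in> I \<or> y = c" if "x \<in> I" "y \<le> x" "c \<le> y" for x y
    using c that unfolding sk_def strict_downset_def downset_def by blast
  \<comment> \<open>By convexity nothing in I lies below c. Hence no arrow leads from I to c, and
    the inclusion j of V_I into V_J is natural.\<close>
  have below: "y \<notin> I" if "y \<le> c" for y
    using I a cI that unfolding convex_subset_def by blast
  define J where "J = insert c I"
  have "convex_subset J"
    unfolding convex_subset_def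
  proof (intro ballI allI impI)
    fix x z y assume xz: "x \<in> J" "z \<in> J" and xyz: "x \<le> y \<and> y \<le> z"
    show "y \<in> J"
    proof (cases "z = c")
      case True
      then have "x = c" using below[of x] order_trans[of x y z] xz xyz J_def by auto
      then show ?thesis using True xyz J_def by auto
    next
      case False
      then have z: "z \<in> I" using xz J_def by auto
      show ?thesis
      proof (cases "x = c")
        case True
        then show ?thesis using max[OF z] xyz J_def by auto
      next
        case False
        then have "x \<in> I" using xz J_def by auto
        then show ?thesis using I z xyz unfolding convex_subset_def J_def by blast
      qed
    qed
  qed
  then have J: "pmodule K (interval_seq K J)" by (rule pmodule_interval_seq[OF K])
  have V: "pmodule K (interval_seq K I)" by (rule pmodule_interval_seq[OF K I])
  define j :: "'p \<Rightarrow> (nat \<Rightarrow> 'k) \<Rightarrow> nat \<Rightarrow> 'k" where "j x v = v" for x v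
  have "linear_map K (ob (interval_seq K I) x) (ob (interval_seq K J) x) (j x)" for x
    by (rule linear_mapI[OF pmoduleD(1)[OF V] pmoduleD(1)[OF J]])
      (auto simp: j_def J_def split: if_splits)
  moreover have "j y (mor (interval_seq K I) y x v) = mor (interval_seq K J) y x (j x v)"
    if "x \<le> y" "v \<in> carrier (ob (interval_seq K I) x)" for x y v
    using below[of x] that by (auto simp: j_def J_def)
  ultimately have j: "pmod_hom K (interval_seq K I) (interval_seq K J) j"
    unfolding pmod_hom_def by blast
  have "pmod_mono (interval_seq K I) j"
    unfolding pmod_mono_def j_def by (auto simp: inj_on_def)
  moreover have "pmod_hom K (interval_seq K I) Q0 (\<lambda>x v. \<eta> x (i x v))"
    by (rule pmod_hom_comp[OF i \<eta>(1)])
  ultimately have "\<exists>h. pmod_hom K (interval_seq K J) Q0 h \<and>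
      (\<forall>x. \<forall>v\<in>carrier (ob (interval_seq K I) x). h x (j x v) = \<eta> x (i x v))"
    using Q0 J V j unfolding injective_def by blast
  then obtain h where h: "pmod_hom K (interval_seq K J) Q0 h"
    and h_j: "\<And>x v. v \<in> carrier (ob (interval_seq K I) x) \<Longrightarrow> h x v = \<eta> x (i x v)"
    unfolding j_def by blast
  have h_one: "h x (\<lambda>_. \<one>\<^bsub>K\<^esub>) = \<eta> x (i x (\<lambda>_. \<one>\<^bsub>K\<^esub>))" if "x \<in> I" for x
    by (rule h_j) (use that in auto)
  have e: "(\<lambda>_. \<one>\<^bsub>K\<^esub>) \<in> carrier (ob (interval_seq K J) c)" by (auto simp: J_def)
  define s where "s = h c (\<lambda>_. \<one>\<^bsub>K\<^esub>)"
  have s: "s \<in> carrier (ob Q0 c)" unfolding s_def by (rule pmod_homD(3)[OF h e])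
  \<comment> \<open>Moving s upwards gives elements of the image of \<eta> only, so d(s) dies
    strictly above c.\<close>
  have mor_s: "mor Q0 y c s = (if y \<in> I then \<eta> y (i y (\<lambda>_. \<one>\<^bsub>K\<^esub>)) else \<zero>\<^bsub>ob Q0 y\<^esub>)"
    if "c < y" for y
    using pmod_homD(2)[OF h less_imp_le[OF that] e] pmod_homD(4)[OF h, of y] h_one[of y] that
    by (auto simp: s_def J_def split: if_splits)
  show "c \<in> supp (soc_pmod K Q1)"
  proof (rule mem_supp_soc_pmodI[OF Q1 pmod_homD(3)[OF d(1) s]])
    show "mor Q1 y c (d c s) = \<zero>\<^bsub>ob Q1 y\<^esub>" if y: "c < y" for y
    proof -
      have "\<eta> y (i y (\<lambda>_. \<one>\<^bsub>K\<^esub>)) \<in> pmod_ker Q0 Q1 d y" if "y \<in> I"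
        using i_one_closed[OF that] unfolding d(2)[symmetric] pmod_im_def by simp
      then have "d y (mor Q0 y c s) = \<zero>\<^bsub>ob Q1 y\<^esub>"
        using pmod_homD(4)[OF d(1), of y] mor_s[OF y] by (auto simp: pmod_ker_def)
      then show ?thesis using pmod_homD(2)[OF d(1) less_imp_le[OF y] s] by simp
    qed
    show "d c s \<noteq> \<zero>\<^bsub>ob Q1 c\<^esub>"
    proof
      \<comment> \<open>If d(s) = 0, exactness gives s = \<eta>(m), and injectivity of \<eta> gives
        M_{a,c} m = i_a(1). Applying r makes 1 the image of r(m) under V_I from c to a, which is
        zero because c is outside I.\<close>
      assume "d c s = \<zero>\<^bsub>ob Q1 c\<^esub>"
      then have "s \<in> pmod_im M \<eta> c" using s unfolding d(2) pmod_ker_def by simp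
      then obtain m where m: "m \<in> carrier (ob M c)" "s = \<eta> c m" unfolding pmod_im_def by auto
      have ca: "c < a" using a cI by (auto simp: less_le)
      have "\<eta> a (mor M a c m) = \<eta> a (i a (\<lambda>_. \<one>\<^bsub>K\<^esub>))"
        using pmod_homD(2)[OF \<eta>(1) a(2) m(1)] mor_s[OF ca] a(1) m(2) by simp
      then have "mor M a c m = i a (\<lambda>_. \<one>\<^bsub>K\<^esub>)"
        using \<eta>(2) pmoduleD(4)[OF M a(2) m(1)] i_one_closed[OF a(1)]
        unfolding pmod_mono_def inj_on_def by blast
      then have "(\<lambda>_. \<one>\<^bsub>K\<^esub>) = mor (interval_seq K I) a c (r c m)"
        using pmod_homD(2)[OF r a(2) m(1)] r_i_one[OF a(1)] by simp
      then show False using cI by (auto dest: fun_cong)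
    qed
  qed
qed

end

section \<open>Assembling the conditions\<close>

theorem proposition3p54:
  fixes K :: "'k ring"
    and M :: "('p::{finite,order}, 'k, 'v) pmod"
    and P :: "nat \<Rightarrow> ('p, 'k, 'u) pmod"
    and Q :: "nat \<Rightarrow> ('p, 'k, 'w) pmod"
    and I :: "'p set"
  assumes "field K"
    and "pmodule K M"
    and "min_proj_resolution K M P \<epsilon> d"
    and "min_inj_coresolution K M Q \<eta> \<delta>"
    and "I \<in> intervals"
    and "iso_to_direct_summand K (interval_pmod K I) M"
  shows "I \<in> crt1zp' K M (P 1) (Q 1)"
proof -
  have "convex_subset I" using assms(5) unfolding intervals_def by blast
  then obtain i r where "interval_retract K M I i r"
    using ex_interval_retract assms by blast
  then interpret interval_retract K M I i r .
  have proj: "projective K (P n)" "pmod_hom K (P (Suc n)) (P n) (d n)" for n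
    using assms(3) unfolding min_proj_resolution_def by blast+
  have inj: "injective K (Q n)" "pmod_hom K (Q n) (Q (Suc n)) (\<delta> n)" for n
    using assms(4) unfolding min_inj_coresolution_def by blast+
  have "pmodule K (P 1)" "pmodule K (Q 1)"
    using conjunct1[OF proj(1)[unfolded projective_def]]
      conjunct1[OF inj(1)[unfolded injective_def]] by blast+
  then have "sc (strict_upset I) \<subseteq> supp (top_pmod K (P 1))"
    and "sk (strict_downset I) \<subseteq> supp (soc_pmod K (Q 1))"
    using assms(3,4) proj(2)[of 0] inj(2)[of 0]
    unfolding min_proj_resolution_def min_inj_coresolution_def
    by (intro sc_strict_upset_subset_supp_top[where ?P0.0 = "P 0" and \<epsilon> = \<epsilon> and d = "d 0"]
          sk_strict_downset_subset_supp_soc[where ?Q0.0 = "Q 0" and \<eta> = \<eta> and d = "\<delta> 0"]; simp)+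
  then show ?thesis
    using assms(5) sc_subset_supp_top sk_subset_supp_soc mor_nonzero
    unfolding crt1zp'_def crt1'_def crt0_def crt_zp_def sc_def sk_def by blast
qed

end
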